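(* For all real $\sigma>0$ and $t>16\pi$, $$|\mathcal{R}(\sigma+it)|\le 2\sqrt{\frac{t}{2\pi}}.$$
   Context: $\mathcal{R}(s)$ is Riemann's auxiliary function, the entire function defined for all $s\in\mathbf{C}$ by $$\mathcal{R}(s)=\int_{L}\frac{x^{-s}e^{\pi i x^2}}{e^{\pi i x}-e^{-\pi i x}}\,dx,$$ where $L$ is the straight line through a point $c$ of the real interval $(0,1)$ (the value does not depend on $c$) parallel to the bisector of the first quadrant, i.e. $\{c+ue^{\pi i/4}:u\in\mathbf{R}\}$, traversed from upper right to lower left ($u$ decreasing from $+\infty$ to $-\infty$), and $x^{-s}=\exp(-s\log x)$ with the principal branch of $\log$. *)

theory Defs
  imports "HOL-Analysis.Analysis"
begin

text \<open>
  Riemann's auxiliary function. The line through \<open>c\<close> is parametrised by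
  \<open>x = c + u * cis (pi / 4)\<close>, whence the factor \<open>cis (pi / 4) = dx / du\<close>; it is traversed from
  upper right to lower left, so the bounds of the integral are reversed. For \<open>0 < c < 1\<close> the
  line avoids the integers and the branch cut of \<^const>\<open>Ln\<close>, the integral converges absolutely, and
  its value is the same for all such \<open>c\<close>.
\<close>

definition riemann_aux_integrand :: "complex \<Rightarrow> complex \<Rightarrow> complex" where
  "riemann_aux_integrand s x =
     exp (- s * Ln x) * exp (pi * \<i> * x\<^sup>2) / (exp (pi * \<i> * x) - exp (- pi * \<i> * x))"

definition riemann_aux :: "real \<Rightarrow> complex \<Rightarrow> complex" where
  "riemann_aux c s =
     (LBINT u=\<infinity>..-\<infinity>. riemann_aux_integrand s (c + u * cis (pi / 4)) * cis (pi / 4))"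

end

theory Submission
  imports Defs "HOL-Complex_Analysis.Complex_Analysis" "HOL-Probability.Distributions"
    "HOL-Real_Asymp.Real_Asymp"
begin

text \<open>
  Put \<open>\<eta> = sqrt (t / 2\<pi>)\<close>, \<open>N = \<lfloor>\<eta>\<rfloor>\<close> and \<open>a = N + 1/2\<close>. Moving the line of integration from \<open>c\<close> to
  \<open>a\<close> crosses the poles \<open>1, \<dots>, N\<close>, whose residues contribute \<open>\<Sum>n\<le>N. n powr (-s)\<close>, of modulus at
  most \<open>N\<close>. On the new line \<open>x = a + v + iv\<close>, which passes close to the saddle point \<open>\<eta>\<close>, we have
  \<open>|x| \<ge> 1\<close>, the denominator is at least \<open>2\<close>, and \<open>Arg x \<le> v / a\<close> for \<open>v > -a\<close>; hence the integrand is
  at most a Gaussian \<open>exp (2\<pi> (k v - v\<^sup>2)) / 2\<close> with \<open>k = (\<eta>\<^sup>2 - a\<^sup>2) / a\<close>, up to a negligible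
  contribution of \<open>v \<le> -a\<close>. The resulting bound is smaller than \<open>2\<eta> - N\<close> because \<open>\<eta> > sqrt 8\<close>.
\<close>

section \<open>Bounds for the argument along a line of slope 1\<close>

text \<open>The right side is the tangent at \<open>v = 0\<close>. For \<open>v \<ge> 0\<close> use
  \<open>arctan y \<le> y\<close>; for \<open>v < 0\<close> the difference of the two sides vanishes
  at 0 and is nonincreasing on \<open>[v, 0]\<close>.\<close>

lemma arctan_line_le:
  fixes a v :: real
  assumes "0 < a" "- a < v"
  shows "arctan (v / (a + v)) \<le> v / a"
proof (cases "0 \<le> v")
  case True
  have "arctan (v / (a + v)) \<le> v / (a + v)"
    using assms True by (intro arctan_le_self) auto
  also have "\<dots> \<le> v / a"
    using assms True by (intro divide_left_mono) auto
  finally show ?thesis .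
next
  case False
  define g where "g = (\<lambda>x. x / a - arctan (x / (a + x)))"
  have "g 0 \<le> g v"
  proof (rule DERIV_nonpos_imp_nonincreasing[of v 0])
    fix x assume x: "v \<le> x" "x \<le> 0"
    then have pos: "a + x > 0"
      using assms by simp
    have dpos: "0 < (a + x)\<^sup>2 + x\<^sup>2"
      using pos by (simp add: add_pos_nonneg)
    \<comment> \<open>The difference of the two sides is \<open>2 * x * (a + x)\<close>, a product
      of factors of opposite sign.\<close>
    have "(a + x)\<^sup>2 + x\<^sup>2 \<le> a\<^sup>2"
      using x pos mult_nonpos_nonneg[of x "a + x"] by (simp add: power2_eq_square algebra_simps)
    then have "1 / a \<le> a / ((a + x)\<^sup>2 + x\<^sup>2)"
      using assms dpos by (simp add: field_simps power2_eq_square)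
    moreover have "(g has_real_derivative (1 / a - a / ((a + x)\<^sup>2 + x\<^sup>2))) (at x)"
    proof -
      have eq: "inverse (1 + (x / (a + x))\<^sup>2) * ((1 * (a + x) - x * 1) / ((a + x) * (a + x)))
          = a / ((a + x)\<^sup>2 + x\<^sup>2)"
        using pos dpos by (simp add: divide_simps power2_eq_square)
      have "(g has_real_derivative
          (1 / a - inverse (1 + (x / (a + x))\<^sup>2) * ((1 * (a + x) - x * 1) / ((a + x) * (a + x))))) (at x)"
        unfolding g_def using pos assms(1)
        by (auto intro!: derivative_eq_intros)
      then show ?thesis unfolding eq .
    qed
    ultimately show "\<exists>y. (g has_real_derivative y) (at x) \<and> y \<le> 0"
      by (intro exI[of _ "1 / a - a / ((a + x)\<^sup>2 + x\<^sup>2)"]) auto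
  qed (use False in simp)
  then show ?thesis by (simp add: g_def)
qed

lemma Im_Ln_line_le:
  fixes a v :: real
  assumes "0 < a" "- a < v"
  shows "Im (Ln (Complex (a + v) v)) \<le> v / a"
proof -
  have "Complex (a + v) v \<noteq> 0"
    using assms by (auto simp: complex_eq_iff)
  then have "Im (Ln (Complex (a + v) v)) = arctan (v / (a + v))"
    using arg_conv_arctan[of "Complex (a + v) v"] assms by (simp add: Arg_eq_Im_Ln)
  then show ?thesis
    using arctan_line_le[OF assms] by simp
qed

text \<open>By elimination: arguments in \<open>(-pi/2, pi/2)\<close> need a positive real part,
  those in \<open>[0, pi]\<close> a nonnegative imaginary part. This serves the part
  \<open>v \<le> -a\<close> of the line, where the arctangent formula fails.\<close>

lemma Im_Ln_third_quadrant:
  assumes "Re z \<le> 0" "Im z < 0"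
  shows "Im (Ln z) \<le> - pi / 2"
proof -
  have "z \<noteq> 0" using assms by auto
  then have "\<not> \<bar>Im (Ln z)\<bar> < pi / 2" and "\<not> (0 \<le> Im (Ln z) \<and> Im (Ln z) \<le> pi)"
    using assms Re_Ln_pos_lt Im_Ln_pos_le by force+
  moreover have "Im (Ln z) \<le> pi"
    using \<open>z \<noteq> 0\<close> by (rule Im_Ln_le_pi)
  ultimately show ?thesis by linarith
qed

section \<open>Modulus of the integrand and of its denominator\<close>

lemma norm_riemann_aux_integrand:
  assumes "x \<noteq> 0"
  shows "cmod (riemann_aux_integrand s x) =
    exp (- Re s * ln (cmod x) + Im s * Im (Ln x) - 2 * pi * (Re x * Im x))
      / cmod (exp (pi * \<i> * x) - exp (- pi * \<i> * x))"
proof -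
  have "cmod (exp (- s * Ln x)) = exp (- Re s * ln (cmod x) + Im s * Im (Ln x))"
    using assms by simp
  moreover have "cmod (exp (pi * \<i> * x\<^sup>2)) = exp (- 2 * pi * (Re x * Im x))"
    by (simp add: power2_eq_square)
  ultimately show ?thesis
    unfolding riemann_aux_integrand_def norm_divide norm_mult by (simp flip: exp_add)
qed

lemma denominator_eq_sin: "exp (pi * \<i> * x) - exp (- pi * \<i> * x) = 2 * \<i> * sin (pi * x)"
  for x :: complex
  unfolding sin_exp_eq by (simp add: field_simps)

lemma denominator_eq_0_iff:
  "exp (pi * \<i> * x) - exp (- pi * \<i> * x) = 0 \<longleftrightarrow> x \<in> \<int>" for x :: complex
proof -
  have "sin (pi * x) = 0 \<longleftrightarrow> x \<in> \<int>"
    by (simp add: sin_eq_0 Ints_def image_iff)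
  then show ?thesis unfolding denominator_eq_sin by simp
qed

text \<open>Reverse triangle inequality: the two exponentials have reciprocal moduli. This is
  effective far from the real axis, on the short edges of the contour.\<close>

lemma norm_denominator_ge:
  "exp (pi * \<bar>Im x\<bar>) - exp (- (pi * \<bar>Im x\<bar>)) \<le> cmod (exp (pi * \<i> * x) - exp (- pi * \<i> * x))"
proof -
  have "cmod (exp (pi * \<i> * x)) = exp (- (pi * Im x))" "cmod (exp (- pi * \<i> * x)) = exp (pi * Im x)"
    by simp_all
  then show ?thesis
    using norm_triangle_ineq3[of "exp (pi * \<i> * x)" "exp (- pi * \<i> * x)"]
    by (cases "0 \<le> Im x") auto
qed

text \<open>Both sides are compared with \<open>\<bar>x\<bar>\<close>; \<open>sinh y - y\<close> is
  nondecreasing for \<open>y \<ge> 0\<close> because \<open>cosh \<ge> 1\<close>.\<close>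

lemma abs_sin_le_abs_sinh: "\<bar>sin x\<bar> \<le> \<bar>sinh x\<bar>" for x :: real
proof -
  have ge: "y \<le> sinh y" if "0 \<le> y" for y :: real
  proof -
    have "sinh 0 - 0 \<le> sinh y - y"
      by (rule DERIV_nonneg_imp_nondecreasing[OF that])
        (auto intro!: derivative_eq_intros exI simp: cosh_real_ge_1)
    then show ?thesis by simp
  qed
  have "\<bar>x\<bar> \<le> \<bar>sinh x\<bar>"
    using ge[of x] ge[of "- x"] by (cases "0 \<le> x") auto
  then show ?thesis using abs_sin_x_le_abs_x[of x] by linarith
qed

text \<open>On a line through a half-integer, \<open>|sin (\<pi> x)|\<^sup>2 = cos\<^sup>2 (\<pi> v) + sinh\<^sup>2 (\<pi> v) \<ge> 1\<close>.\<close>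

lemma norm_denominator_half_integer:
  fixes N :: nat
  shows "2 \<le> cmod (exp (pi * \<i> * Complex (N + 1/2 + v) v) - exp (- pi * \<i> * Complex (N + 1/2 + v) v))"
proof -
  define x where "x = Complex (N + 1/2 + v) v"
  have "sin (pi * (N + 1/2 + v)) = sin (pi * v + pi / 2 + N * pi)"
    by (simp add: algebra_simps)
  also have "\<dots> = (- 1) ^ N * cos (pi * v)"
    by (subst sin_add) (simp add: sin_add cos_add)
  finally have s: "(sin (pi * (N + 1/2 + v)))\<^sup>2 = (cos (pi * v))\<^sup>2"
    by (simp add: power_mult_distrib flip: power_mult)
  have "(cmod (sin (pi * x)))\<^sup>2 = (sin (pi * (N + 1/2 + v)))\<^sup>2 + (sinh (pi * v))\<^sup>2"
  proof -
    define p q where "p = pi * (N + 1/2 + v)" and "q = pi * v"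
    have "sin (pi * x) = sin (Complex p q)"
      by (rule arg_cong[of _ _ sin]) (simp add: x_def p_def q_def complex_eq_iff)
    moreover have "(cmod (sin (Complex p q)))\<^sup>2 = (sin p)\<^sup>2 + (sinh q)\<^sup>2"
    proof -
      have e: "exp (2 * q) = exp q * exp q"
        by (simp flip: exp_add)
      show ?thesis
        unfolding norm_sin_squared complex.sel cos_double_sin e
        by (simp add: sinh_field_def exp_minus field_simps power2_eq_square)
    qed
    ultimately show ?thesis by (simp only: p_def q_def)
  qed
  also have "\<dots> = 1 - (sin (pi * v))\<^sup>2 + (sinh (pi * v))\<^sup>2"
    unfolding s by (simp add: cos_squared_eq)
  also have "\<dots> \<ge> 1"
    using abs_sin_le_abs_sinh[of "pi * v"] abs_le_square_iff[of "sin (pi * v)" "sinh (pi * v)"] by simp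
  finally have "1\<^sup>2 \<le> (cmod (sin (pi * x)))\<^sup>2"
    by simp
  then have "1 \<le> cmod (sin (pi * x))"
    by (rule power2_le_imp_le) simp
  then show ?thesis
    unfolding x_def[symmetric] denominator_eq_sin by (simp add: norm_mult)
qed

section \<open>Gaussian majorant on the line through a half-integer\<close>

text \<open>The integrand is a multiple of the normal density with variance
  \<open>1 / (2 * p)\<close>.\<close>

lemma has_bochner_integral_gaussian:
  fixes p m :: real
  assumes "0 < p"
  shows "has_bochner_integral lborel (\<lambda>y. exp (- p * (y - m)\<^sup>2)) (sqrt (pi / p))"
proof -
  define \<sigma> where "\<sigma> = 1 / sqrt (2 * p)"
  have "\<sigma> > 0" and \<sigma>2: "\<sigma>\<^sup>2 = 1 / (2 * p)"
    using assms by (simp_all add: \<sigma>_def power_divide)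
  have "has_bochner_integral lborel (\<lambda>y. sqrt (pi / p) * normal_density m \<sigma> y) (sqrt (pi / p) * 1)"
    using \<open>\<sigma> > 0\<close> by (intro has_bochner_integral_mult_right) (simp add: has_bochner_integral_iff)
  also have "(\<lambda>y. sqrt (pi / p) * normal_density m \<sigma> y) = (\<lambda>y. exp (- p * (y - m)\<^sup>2))"
    using assms by (simp add: normal_density_def \<sigma>2 fun_eq_iff field_simps)
  finally show ?thesis by simp
qed

text \<open>For \<open>t = 2 * pi * \<eta>\<^sup>2\<close> the left side is, up to the factor
  \<open>2 * pi\<close>, the logarithm of the modulus of
  \<open>x powr (- \<i> * t) * exp (pi * \<i> * x\<^sup>2)\<close>. Replacing the argument by its
  bound \<open>v / a\<close> makes it quadratic in \<open>v\<close>.\<close>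

lemma saddle_exponent_le:
  fixes a \<eta> v :: real
  assumes "0 < a" "- a < v"
  shows "\<eta>\<^sup>2 * Im (Ln (Complex (a + v) v)) - (a + v) * v \<le> (\<eta>\<^sup>2 - a\<^sup>2) / a * v - v\<^sup>2"
proof -
  have "\<eta>\<^sup>2 * Im (Ln (Complex (a + v) v)) \<le> \<eta>\<^sup>2 * (v / a)"
    using Im_Ln_line_le assms by (intro mult_left_mono) auto
  then show ?thesis
    using assms by (simp add: field_simps power2_eq_square)
qed

text \<open>Here the argument is at most \<open>- pi / 2\<close>, which contributes at most
  \<open>- (a\<^sup>2 + 1) / 2\<close>, while \<open>0 \<le> (a + v)\<^sup>2\<close> gives
  \<open>- (a + v) * v \<le> (a\<^sup>2 - v\<^sup>2) / 2\<close>.\<close>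

lemma saddle_exponent_le_far:
  fixes a \<eta> v :: real
  assumes "0 < a" "a\<^sup>2 + 1 \<le> pi * \<eta>\<^sup>2" "v \<le> - a"
  shows "\<eta>\<^sup>2 * Im (Ln (Complex (a + v) v)) - (a + v) * v \<le> - (v\<^sup>2 + 1) / 2"
proof -
  have "\<eta>\<^sup>2 * Im (Ln (Complex (a + v) v)) \<le> \<eta>\<^sup>2 * (- pi / 2)"
    using assms by (intro mult_left_mono Im_Ln_third_quadrant) auto
  moreover have "0 \<le> (a + v)\<^sup>2" by simp
  ultimately show ?thesis
    using assms(2) by (simp add: field_simps power2_eq_square)
qed

text \<open>The sum of the bounds for \<open>v > -a\<close> and \<open>v \<le> -a\<close> is valid
  on the whole line, so that the integration needs no splitting.\<close>

lemma norm_integrand_saddle_line_le: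
  fixes N :: nat and a \<eta> \<sigma> v :: real
  assumes "2 \<le> N" and a: "a = N + 1/2" and \<eta>: "a\<^sup>2 + 1 \<le> pi * \<eta>\<^sup>2" and "0 < \<sigma>"
  shows "cmod (riemann_aux_integrand (Complex \<sigma> (2 * pi * \<eta>\<^sup>2)) (Complex (a + v) v))
    \<le> (exp (2 * pi * ((\<eta>\<^sup>2 - a\<^sup>2) / a * v - v\<^sup>2)) + exp (- pi * (v\<^sup>2 + 1))) / 2"
proof -
  define x where "x = Complex (a + v) v"
  define h where "h = \<eta>\<^sup>2 * Im (Ln x) - (a + v) * v"
  have a2: "a \<ge> 5/2" using assms by simp
  have "2 \<le> (5/2)\<^sup>2 / (2::real)" by (simp add: power2_eq_square)
  also have "\<dots> \<le> a\<^sup>2 / 2"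
    using a2 by (intro divide_right_mono power_mono) auto
  \<comment> \<open>The difference of the two sides is \<open>(a + 2 * v)\<^sup>2 / 2\<close>: the
    point of the line nearest to 0 has \<open>v = - a / 2\<close>.\<close>
  also have "\<dots> \<le> (a + v)\<^sup>2 + v\<^sup>2"
    using zero_le_power2[of "a + 2 * v"] by (simp add: power2_eq_square algebra_simps)
  finally have "1\<^sup>2 \<le> (cmod x)\<^sup>2"
    by (simp add: x_def cmod_power2)
  then have x1: "1 \<le> cmod x"
    by (rule power2_le_imp_le) simp
  then have "x \<noteq> 0" by auto
  have "cmod (riemann_aux_integrand (Complex \<sigma> (2 * pi * \<eta>\<^sup>2)) x)
    = exp (2 * pi * h - \<sigma> * ln (cmod x)) / cmod (exp (pi * \<i> * x) - exp (- pi * \<i> * x))"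
    unfolding norm_riemann_aux_integrand[OF \<open>x \<noteq> 0\<close>]
    by (simp add: h_def x_def algebra_simps)
  also have "\<dots> \<le> exp (2 * pi * h) / 2"
    using x1 \<open>0 < \<sigma>\<close> norm_denominator_half_integer[of N v]
    by (intro frac_le) (auto simp: x_def a)
  also have "exp (2 * pi * h) \<le> exp (2 * pi * ((\<eta>\<^sup>2 - a\<^sup>2) / a * v - v\<^sup>2)) + exp (- pi * (v\<^sup>2 + 1))"
  proof (cases "- a < v")
    case True
    then have "h \<le> (\<eta>\<^sup>2 - a\<^sup>2) / a * v - v\<^sup>2"
      using saddle_exponent_le[of a v \<eta>] a2 by (simp add: h_def x_def)
    then have "exp (2 * pi * h) \<le> exp (2 * pi * ((\<eta>\<^sup>2 - a\<^sup>2) / a * v - v\<^sup>2))"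
      by (simp add: mult_left_mono)
    then show ?thesis by (simp add: add_increasing2)
  next
    case False
    then have "h \<le> - (v\<^sup>2 + 1) / 2"
      using saddle_exponent_le_far[of a \<eta> v] a2 \<eta> by (simp add: h_def x_def)
    then have "2 * pi * h \<le> 2 * pi * (- (v\<^sup>2 + 1) / 2)"
      by (intro mult_left_mono) auto
    also have "\<dots> = - pi * (v\<^sup>2 + 1)"
      by (simp add: field_simps)
    finally have "exp (2 * pi * h) \<le> exp (- pi * (v\<^sup>2 + 1))"
      by (simp only: exp_le_cancel_iff)
    then show ?thesis by (simp add: add_increasing)
  qed
  finally show ?thesis unfolding x_def by simp
qed

text \<open>The bound is the integral of the majorant over all of \<real>, hence independent of
  \<open>U\<close>.\<close>

lemma saddle_line_bound:
  fixes N :: nat and a \<eta> \<sigma> U :: real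
  assumes "2 \<le> N" and a: "a = N + 1/2" and \<eta>: "a\<^sup>2 + 1 \<le> pi * \<eta>\<^sup>2" and "0 < \<sigma>"
    and cont: "continuous_on {-U..U} (\<lambda>y. riemann_aux_integrand (Complex \<sigma> (2 * pi * \<eta>\<^sup>2))
      (cis (- pi / 4) * Complex (a / sqrt 2) y))"
  shows "cmod (integral {-U..U} (\<lambda>y. riemann_aux_integrand (Complex \<sigma> (2 * pi * \<eta>\<^sup>2))
      (cis (- pi / 4) * Complex (a / sqrt 2) y)))
    \<le> (exp (pi * ((\<eta>\<^sup>2 - a\<^sup>2) / a)\<^sup>2 / 2) + sqrt 2 * exp (- pi)) / 2"
proof -
  define k where "k = (\<eta>\<^sup>2 - a\<^sup>2) / a"
  define g where "g = (\<lambda>y. riemann_aux_integrand (Complex \<sigma> (2 * pi * \<eta>\<^sup>2))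
    (cis (- pi / 4) * Complex (a / sqrt 2) y))"
  \<comment> \<open>The majorant in the variable \<open>y = sqrt 2 * v + a / sqrt 2\<close>.
    Completing the square in \<open>k * v - v\<^sup>2\<close> yields the factor
    \<open>exp (pi * k\<^sup>2 / 2)\<close> and the centre \<open>(a + k) / sqrt 2\<close>.\<close>
  define D where "D = (\<lambda>y. (exp (pi * k\<^sup>2 / 2) * exp (- pi * (y - (a + k) / sqrt 2)\<^sup>2)
      + exp (- pi) * exp (- (pi / 2) * (y - a / sqrt 2)\<^sup>2)) / 2)"
  have "has_bochner_integral lborel D ((exp (pi * k\<^sup>2 / 2) * sqrt (pi / pi) + exp (- pi) * sqrt (pi / (pi / 2))) / 2)"
    unfolding D_def
    by (intro has_bochner_integral_divide_zero has_bochner_integral_add has_bochner_integral_mult_right has_bochner_integral_gaussian) auto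
  then have "integrable lborel D"
    and "integral\<^sup>L lborel D = (exp (pi * k\<^sup>2 / 2) + sqrt 2 * exp (- pi)) / 2"
    by (auto simp: has_bochner_integral_iff mult.commute)
  then have D: "(D has_integral ((exp (pi * k\<^sup>2 / 2) + sqrt 2 * exp (- pi)) / 2)) UNIV"
    using has_integral_integral_lborel[of D] by metis
  have D0: "0 \<le> D y" for y by (simp add: D_def)
  have le: "cmod (g y) \<le> D y" for y
  proof -
    define v where "v = (y - a / sqrt 2) / sqrt 2"
    have y: "y = sqrt 2 * v + a / sqrt 2" by (simp add: v_def)
    have x: "cis (- pi / 4) * Complex (a / sqrt 2) y = Complex (a + v) v"
      by (simp add: complex_eq_iff cos_45 sin_45 y field_simps)
    have "2 * pi * (k * v - v\<^sup>2) = pi * k\<^sup>2 / 2 + (- pi * (y - (a + k) / sqrt 2)\<^sup>2)"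
      by (simp add: y power2_eq_square field_simps)
    moreover have "- pi * (v\<^sup>2 + 1) = - pi + (- (pi / 2) * (y - a / sqrt 2)\<^sup>2)"
      by (simp add: y power2_eq_square field_simps)
    ultimately have "D y = (exp (2 * pi * (k * v - v\<^sup>2)) + exp (- pi * (v\<^sup>2 + 1))) / 2"
      unfolding D_def by (simp only: exp_add)
    then show ?thesis
      using norm_integrand_saddle_line_le[OF assms(1-4), of v] unfolding g_def x k_def by metis
  qed
  have "D integrable_on {-U..U}"
    using D integrable_on_subinterval[of D UNIV "-U" U] by auto
  then have "cmod (integral {-U..U} g) \<le> integral {-U..U} D"
    using le integrable_continuous_interval[OF cont] unfolding g_def
    by (intro integral_norm_bound_integral)
  also have "\<dots> \<le> integral UNIV D"
    using D D0 \<open>D integrable_on {-U..U}\<close> by (intro integral_subset_le) auto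
  also have "\<dots> = (exp (pi * k\<^sup>2 / 2) + sqrt 2 * exp (- pi)) / 2"
    using D by (rule integral_unique)
  finally show ?thesis unfolding g_def k_def .
qed

section \<open>Numerical comparison with \<open>2 * \<eta>\<close>\<close>

lemma saddle_numerics:
  fixes N :: nat and a \<eta> :: real
  assumes "real N \<le> \<eta>" "\<eta> < N + 1" "8 < \<eta>\<^sup>2" and a: "a = N + 1/2"
  shows "2 \<le> N" and "a\<^sup>2 + 1 \<le> pi * \<eta>\<^sup>2"
    and "N + (exp (pi * ((\<eta>\<^sup>2 - a\<^sup>2) / a)\<^sup>2 / 2) + sqrt 2 * exp (- pi)) / 2 \<le> 2 * \<eta>"
proof -
  have "0 \<le> \<eta>" using assms(1) by linarith
  \<comment> \<open>\<open>(14/5)\<^sup>2 = 7.84 < 8\<close>.\<close>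
  have \<eta>: "14/5 < \<eta>"
    by (rule power_less_imp_less_base[of _ 2]) (use assms \<open>0 \<le> \<eta>\<close> in \<open>auto simp: power2_eq_square\<close>)
  show N: "2 \<le> N"
    using assms(2) \<eta> by linarith
  have "real N ^ 2 \<le> \<eta>\<^sup>2"
    using assms(1) by (intro power_mono) auto
  moreover have "\<eta> \<le> \<eta>\<^sup>2"
    using \<eta> by (simp add: power2_eq_square)
  ultimately have "a\<^sup>2 + 1 \<le> 3 * \<eta>\<^sup>2"
    using assms(1,3) unfolding a by (simp add: power2_eq_square algebra_simps)
  also have "\<dots> \<le> pi * \<eta>\<^sup>2"
    using pi_gt3 by (intro mult_right_mono) auto
  finally show "a\<^sup>2 + 1 \<le> pi * \<eta>\<^sup>2" .

  \<comment> \<open>The offset \<delta> of the saddle point from the half-integer lies in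
    \<open>[-1/2, 1/2]\<close>, so \<open>k\<close> lies between -1 and 11/10.\<close>
  define \<delta> k where "\<delta> = \<eta> - a" and "k = (\<eta>\<^sup>2 - a\<^sup>2) / a"
  have a2: "5/2 \<le> a" using N a by simp
  have \<delta>: "\<bar>\<delta>\<bar> \<le> 1/2"
    using assms(1,2) a unfolding \<delta>_def abs_le_iff by linarith
  have k: "k = 2 * \<delta> + \<delta>\<^sup>2 / a"
    using a2 by (simp add: k_def \<delta>_def field_simps power2_eq_square)
  have "\<delta>\<^sup>2 \<le> (1/2)\<^sup>2"
    using \<delta> by (intro abs_le_square_iff[THEN iffD1]) simp
  then have "\<delta>\<^sup>2 / a \<le> (1/2)\<^sup>2 / (5/2)"
    using a2 by (intro frac_le) auto
  then have k_upper: "k \<le> 2 * \<delta> + 1/10"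
    unfolding k by (simp add: power2_eq_square)
  have k_lower: "- 1 \<le> k"
  proof -
    have "0 \<le> \<delta>\<^sup>2 / a"
      using a2 by simp
    then show ?thesis
      using \<delta> unfolding k abs_le_iff by linarith
  qed
  have pi: "pi < 16/5"
    using pi_approx by simp
  have "sqrt 2 * exp (- pi) \<le> 3/2 * (1/10)"
  proof (rule mult_mono)
    show "sqrt 2 \<le> 3/2"
      by (rule real_le_lsqrt) (auto simp: power2_eq_square)
    have "5/2 \<le> (exp 1 :: real)"
      using e_approx_32 unfolding abs_le_iff by simp
    then have "(5/2) ^ 3 \<le> (exp 1 :: real) ^ 3"
      by (intro power_mono) auto
    also have "\<dots> = exp 3"
      by (simp flip: exp_of_nat_mult)
    also have "\<dots> \<le> exp pi"
      using pi_gt3 by simp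
    finally show "exp (- pi) \<le> 1/10"
      by (simp add: exp_minus field_simps)
  qed auto
  \<comment> \<open>3/40 is half of the bound \<open>3/2 * (1/10)\<close> for the far part. If
    \<open>k \<le> 1\<close>, it suffices that \<open>N \<le> \<eta>\<close> and
    \<open>5/2 + 3/40 < 14/5 < \<eta>\<close>. If \<open>k > 1\<close>, the exponential is larger,
    but then \<open>2 * \<delta> > 9/10\<close>, so \<eta> lies well above \<open>N\<close>.\<close>
  moreover have "N + exp (pi * k\<^sup>2 / 2) / 2 + 3/40 \<le> 2 * \<eta>"
  proof (cases "k \<le> 1")
    case True
    have "pi * k\<^sup>2 / 2 \<le> 16/5 * 1\<^sup>2 / 2"
      using pi True k_lower
      by (intro divide_right_mono mult_mono abs_le_square_iff[THEN iffD1]) auto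
    then have "exp (pi * k\<^sup>2 / 2) \<le> exp (8/5)"
      by simp
    moreover have "exp (8/5) \<le> (5::real)"
    \<comment> \<open>Fifth powers are compared: \<open>2.72 ^ 8\<close> is just below
      \<open>5 ^ 5 = 3125\<close>.\<close>
    proof (rule power_le_imp_le_base[of _ 4])
      have "exp (8/5) ^ 5 = (exp 1 :: real) ^ 8"
        by (simp flip: exp_of_nat_mult)
      also have "\<dots> \<le> (272/100) ^ 8"
        using e_less_272 by (intro power_mono) auto
      also have "\<dots> \<le> 5 ^ 5"
        by (simp add: power_divide)
      finally show "exp (8/5) ^ Suc 4 \<le> (5::real) ^ Suc 4"
        by simp
    qed simp
    ultimately show ?thesis
      using \<eta> assms(1) by linarith
  next
    case False
    have "pi * k\<^sup>2 / 2 \<le> 16/5 * (11/10)\<^sup>2 / 2"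
      using pi False k_upper \<delta>
      by (intro divide_right_mono mult_mono power_mono) auto
    also have "\<dots> \<le> 2"
      by (simp add: power2_eq_square)
    finally have "exp (pi * k\<^sup>2 / 2) \<le> exp 2"
      by simp
    also have "exp 2 = (exp 1 :: real) ^ 2"
      by (simp flip: exp_of_nat_mult)
    also have "\<dots> \<le> (272/100) ^ 2"
      using e_less_272 by (intro power_mono) auto
    finally have "exp (pi * k\<^sup>2 / 2) \<le> 37/5"
      by (simp add: power2_eq_square)
    moreover have "2 * \<eta> = N + (a + 1/2) + 2 * \<delta>"
      by (simp add: \<delta>_def a)
    ultimately show ?thesis
      using False k_upper a2 by linarith
  qed
  ultimately show "N + (exp (pi * ((\<eta>\<^sup>2 - a\<^sup>2) / a)\<^sup>2 / 2) + sqrt 2 * exp (- pi)) / 2 \<le> 2 * \<eta>"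
    unfolding k_def by argo
qed

section \<open>Rotated integrand, its poles and residues\<close>

text \<open>The substitution \<open>w = cis (\<pi> / 4) * x\<close> makes the lines of integration vertical, so that the
  contour to be closed is an axis-parallel rectangle.\<close>

definition rotated_integrand :: "complex \<Rightarrow> complex \<Rightarrow> complex" where
  "rotated_integrand s w = riemann_aux_integrand s (cis (- pi / 4) * w)"

lemma rotate_coords:
  "Re (cis (- pi / 4) * w) = (Re w + Im w) / sqrt 2"
  "Im (cis (- pi / 4) * w) = (Im w - Re w) / sqrt 2"
  by (simp_all add: cos_45 sin_45 field_simps)

text \<open>The right half-plane is turned into the sector of arguments between
  \<open>- 3 * pi / 4\<close> and \<open>pi / 4\<close>, which avoids the branch cut of
  \<open>Ln\<close>.\<close>

lemma rotate_nonpos_Reals: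
  assumes "0 < Re w"
  shows "cis (- pi / 4) * w \<notin> \<real>\<^sub>\<le>\<^sub>0"
proof
  assume "cis (- pi / 4) * w \<in> \<real>\<^sub>\<le>\<^sub>0"
  then have "(Re w + Im w) / sqrt 2 \<le> 0" "(Im w - Re w) / sqrt 2 = 0"
    unfolding complex_nonpos_Reals_iff rotate_coords by auto
  then show False using assms by (simp add: divide_le_0_iff)
qed

lemma rotate_Ints:
  assumes "0 < Re w" "cis (- pi / 4) * w \<in> \<int>"
  obtains n :: nat where "1 \<le> n" "w = n * cis (pi / 4)"
proof -
  from assms(2) obtain m :: int where m: "cis (- pi / 4) * w = of_int m"
    by (auto simp: Ints_def)
  have "w = cis (pi / 4) * (cis (- pi / 4) * w)"
    by (simp add: mult.assoc[symmetric] cis_mult)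
  then have w: "w = of_int m * cis (pi / 4)"
    unfolding m by (simp add: mult.commute)
  then have "0 < m * (sqrt 2 / 2)"
    using assms(1) by (simp add: cos_45)
  then have "0 < m"
    by (simp add: zero_less_mult_iff)
  then show thesis
    using w by (intro that[of "nat m"]) auto
qed

lemma pole_coords:
  fixes n :: nat
  shows "Re (n * cis (pi / 4)) = n / sqrt 2" "Im (n * cis (pi / 4)) = n / sqrt 2"
  by (simp_all add: cos_45 sin_45 field_simps)

lemma holomorphic_numerator:
  "(\<lambda>w. exp (- s * Ln (cis (- pi / 4) * w)) * exp (pi * \<i> * (cis (- pi / 4) * w)\<^sup>2)) holomorphic_on {w. 0 < Re w}"
  by (intro holomorphic_intros) (use rotate_nonpos_Reals in blast)

lemma holomorphic_denominator:
  "(\<lambda>w. exp (pi * \<i> * (cis (- pi / 4) * w)) - exp (- pi * \<i> * (cis (- pi / 4) * w))) holomorphic_on A"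
  by (intro holomorphic_intros)

lemma rotated_integrand_holomorphic:
  "rotated_integrand s holomorphic_on {w. 0 < Re w} - (\<lambda>n::nat. n * cis (pi / 4)) ` {1..}"
  unfolding rotated_integrand_def riemann_aux_integrand_def
proof (rule holomorphic_on_divide)
  show "(\<lambda>w. exp (- s * Ln (cis (- pi / 4) * w)) * exp (pi * \<i> * (cis (- pi / 4) * w)\<^sup>2))
      holomorphic_on {w. 0 < Re w} - (\<lambda>n::nat. n * cis (pi / 4)) ` {1..}"
    using holomorphic_numerator by (rule holomorphic_on_subset) auto
  fix w assume "w \<in> {w. 0 < Re w} - (\<lambda>n::nat. n * cis (pi / 4)) ` {1..}"
  then show "exp (pi * \<i> * (cis (- pi / 4) * w)) - exp (- pi * \<i> * (cis (- pi / 4) * w)) \<noteq> 0"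
    unfolding denominator_eq_0_iff by (auto elim: rotate_Ints)
qed (rule holomorphic_denominator)

text \<open>At a simple pole the residue of \<open>P / Q\<close> is \<open>P / Q'\<close>. Here
  \<open>\<bar>Q'\<bar> = 2 * pi\<close> cancels the factor in front, and
  \<open>\<bar>P\<bar> = n powr (- Re s) \<le> 1\<close>.\<close>

lemma norm_residue_rotated_integrand:
  fixes n :: nat
  assumes "1 \<le> n" "0 \<le> Re s"
  shows "cmod (2 * pi * \<i> * residue (rotated_integrand s) (n * cis (pi / 4))) \<le> 1"
proof -
  define w where "w = n * cis (pi / 4)"
  define P where "P = (\<lambda>w. exp (- s * Ln (cis (- pi / 4) * w)) * exp (pi * \<i> * (cis (- pi / 4) * w)\<^sup>2))"
  define Q where "Q = (\<lambda>w. exp (pi * \<i> * (cis (- pi / 4) * w)) - exp (- pi * \<i> * (cis (- pi / 4) * w)))"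
  \<comment> \<open>The derivative of \<open>Q\<close> at the pole, where both exponentials equal
    \<open>(- 1) ^ n\<close>.\<close>
  define Q' where "Q' = pi * \<i> * cis (- pi / 4) * (2 * (- 1) ^ n)"
  have Re: "0 < Re w"
    using assms(1) by (simp add: w_def cos_45)
  have x: "cis (- pi / 4) * w = of_nat n"
    by (simp add: w_def cis_mult mult.left_commute)
  have e: "exp (pi * \<i> * of_nat n) = (- 1) ^ n" "exp (- pi * \<i> * of_nat n) = (- 1) ^ n"
  proof -
    show *: "exp (pi * \<i> * of_nat n) = (- 1) ^ n"
      by (metis exp_of_nat2_mult exp_pi_i)
    show "exp (- pi * \<i> * of_nat n) = (- 1) ^ n"
      using * by (simp add: exp_minus flip: power_inverse)
  qed
  have "Q w = 0"
    unfolding Q_def denominator_eq_0_iff x by simp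
  have "(Q has_field_derivative
      exp (pi * \<i> * (cis (- pi / 4) * w)) * (pi * \<i> * cis (- pi / 4))
      - exp (- pi * \<i> * (cis (- pi / 4) * w)) * (- pi * \<i> * cis (- pi / 4))) (at w)"
    unfolding Q_def by (auto intro!: derivative_eq_intros)
  then have Q': "(Q has_field_derivative Q') (at w)"
    unfolding x e Q'_def by (simp add: algebra_simps)
  have "P w \<noteq> 0" by (simp add: P_def)
  have "rotated_integrand s = (\<lambda>w. P w / Q w)"
    by (simp add: fun_eq_iff rotated_integrand_def riemann_aux_integrand_def P_def Q_def)
  moreover have "residue (\<lambda>w. P w / Q w) w = P w / Q'"
  proof (rule residue_simple_pole_deriv[where s = "{w. 0 < Re w}"])
    show "P holomorphic_on {w. 0 < Re w}"
      unfolding P_def by (rule holomorphic_numerator)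
    show "Q holomorphic_on {w. 0 < Re w}"
      unfolding Q_def by (rule holomorphic_denominator)
    show "connected {w. 0 < Re w}"
      by (intro convex_connected convex_halfspace_Re_gt)
    show "Q' \<noteq> 0" by (simp add: Q'_def)
  qed (use Re Q' \<open>P w \<noteq> 0\<close> \<open>Q w = 0\<close> in \<open>auto simp: open_halfspace_Re_gt\<close>)
  ultimately have "residue (rotated_integrand s) w = P w / Q'"
    by simp
  moreover have "cmod (P w) \<le> 1"
  proof -
    have "ln (of_nat n :: complex) = of_real (ln n)"
      using assms(1) by (metis Ln_of_real of_real_of_nat_eq of_nat_0_less_iff less_le_trans zero_less_one)
    then show ?thesis
      unfolding P_def x norm_mult using assms by (simp add: power2_eq_square)
  qed
  moreover have "cmod Q' = 2 * pi"
    by (simp add: Q'_def norm_mult norm_power)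
  ultimately show ?thesis
    unfolding w_def[symmetric] by (simp add: norm_mult norm_divide)
qed

section \<open>Moving the line of integration\<close>

text \<open>The decay comes from \<open>2 * Re x * Im x = (Im w)\<^sup>2 - (Re w)\<^sup>2\<close>;
  the argument costs at most \<open>pi * \<bar>Im s\<bar>\<close>. The margin 2 in
  \<open>\<beta> + 2 \<le> U\<close> forces \<open>\<bar>Im x\<bar> \<ge> 1\<close>, so that neither
  the denominator nor the power of \<open>x\<close> enlarges the bound.\<close>

lemma norm_rotated_integrand_edge_le:
  assumes "0 \<le> Re s" "0 < Re w" "Re w \<le> \<beta>" "\<bar>Im w\<bar> = U" "\<beta> + 2 \<le> U"
  shows "cmod (rotated_integrand s w) \<le> exp (pi * (\<bar>Im s\<bar> + \<beta>\<^sup>2) - pi * U\<^sup>2)"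
proof -
  define x where "x = cis (- pi / 4) * w"
  have "sqrt 2 \<le> 2"
    by (rule real_le_lsqrt) auto
  also have "2 \<le> \<bar>Im w - Re w\<bar>"
    using assms by linarith
  finally have Im: "1 \<le> \<bar>Im x\<bar>"
    unfolding x_def rotate_coords by (simp add: abs_divide)
  then have x1: "1 \<le> cmod x"
    using abs_Im_le_cmod[of x] by linarith
  then have "x \<noteq> 0" by auto
  have "1 \<le> pi * \<bar>Im x\<bar>"
    using mult_mono[of 1 pi 1 "\<bar>Im x\<bar>"] Im pi_gt3 by simp
  then have "2 \<le> exp (pi * \<bar>Im x\<bar>)" "exp (- (pi * \<bar>Im x\<bar>)) \<le> 1"
    using exp_ge_add_one_self[of "pi * \<bar>Im x\<bar>"] by (linarith, simp)
  then have den: "1 \<le> cmod (exp (pi * \<i> * x) - exp (- pi * \<i> * x))"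
    using norm_denominator_ge[of x] by linarith
  have "cmod (rotated_integrand s w)
    = exp (- Re s * ln (cmod x) + Im s * Im (Ln x) - 2 * pi * (Re x * Im x))
      / cmod (exp (pi * \<i> * x) - exp (- pi * \<i> * x))"
    unfolding rotated_integrand_def x_def[symmetric] by (rule norm_riemann_aux_integrand) fact
  also have "\<dots> \<le> exp (- Re s * ln (cmod x) + Im s * Im (Ln x) - 2 * pi * (Re x * Im x)) / 1"
    using den by (intro divide_left_mono) auto
  also have "\<dots> \<le> exp (pi * (\<bar>Im s\<bar> + \<beta>\<^sup>2) - pi * U\<^sup>2)"
  proof -
    have "0 \<le> Re s * ln (cmod x)"
      using assms(1) x1 by simp
    moreover have "Im s * Im (Ln x) \<le> pi * \<bar>Im s\<bar>"
    proof -
      have "\<bar>Im (Ln x)\<bar> \<le> pi"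
        using mpi_less_Im_Ln[OF \<open>x \<noteq> 0\<close>] Im_Ln_le_pi[OF \<open>x \<noteq> 0\<close>] by linarith
      then have "\<bar>Im s * Im (Ln x)\<bar> \<le> \<bar>Im s\<bar> * pi"
        unfolding abs_mult by (intro mult_left_mono) auto
      then show ?thesis by (simp add: mult.commute)
    qed
    moreover have "2 * pi * (Re x * Im x) = pi * U\<^sup>2 - pi * (Re w)\<^sup>2"
    proof -
      have "2 * (Re x * Im x) = (Im w)\<^sup>2 - (Re w)\<^sup>2"
        unfolding x_def rotate_coords by (simp add: field_simps power2_eq_square)
      moreover have "(Im w)\<^sup>2 = U\<^sup>2"
        using assms(4) by (metis power2_abs)
      ultimately have "pi * (2 * (Re x * Im x)) = pi * (U\<^sup>2 - (Re w)\<^sup>2)"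
        by simp
      then show ?thesis by (simp add: algebra_simps)
    qed
    moreover have "pi * (Re w)\<^sup>2 \<le> pi * \<beta>\<^sup>2"
      using assms by (intro mult_left_mono power_mono) auto
    ultimately show ?thesis
      unfolding div_by_1 exp_le_cancel_iff distrib_left by linarith
  qed
  finally show ?thesis .
qed

text \<open>Residue theorem on the rectangle with vertical sides at \<alpha> and \<beta>, which
  correspond to the original lines through \<open>\<alpha> * sqrt 2\<close> and
  \<open>\<beta> * sqrt 2\<close>. The \<open>N\<close> enclosed residues contribute at most 1 each;
  the last summand bounds the two horizontal edges.\<close>

lemma line_integral_shift:
  fixes N :: nat and \<alpha> \<beta> U :: real
  assumes s: "0 \<le> Re s" and \<alpha>: "0 < \<alpha>" "\<alpha> * sqrt 2 < 1" and \<beta>: "N < \<beta> * sqrt 2" "\<beta> * sqrt 2 < N + 1"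
    and "1 \<le> N" and U: "\<beta> + 2 \<le> U"
  shows "cmod (integral {-U..U} (\<lambda>y. rotated_integrand s (Complex \<alpha> y)))
    \<le> cmod (integral {-U..U} (\<lambda>y. rotated_integrand s (Complex \<beta> y))) + N
      + 2 * (exp (pi * (\<bar>Im s\<bar> + \<beta>\<^sup>2) - pi * U\<^sup>2) * (\<beta> - \<alpha>))"
proof -
  let ?G = "rotated_integrand s"
  let ?B = "exp (pi * (\<bar>Im s\<bar> + \<beta>\<^sup>2) - pi * U\<^sup>2) * (\<beta> - \<alpha>)"
  \<comment> \<open>An open strip containing the closed rectangle; it ends at the abscissa of pole
    \<open>N + 1\<close>, so that only the poles \<open>1, \<dots>, N\<close> lie in it.\<close>
  define S where "S = {w. 0 < Re w \<and> Re w < (N + 1) / sqrt 2}"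
  define pts where "pts = (\<lambda>n::nat. n * cis (pi / 4)) ` {1..N}"
  define a1 a2 a3 a4 where "a1 = Complex \<alpha> (- U)" and "a2 = Complex \<beta> (- U)"
    and "a3 = Complex \<beta> U" and "a4 = Complex \<alpha> U"
  have "\<alpha> * sqrt 2 < \<beta> * sqrt 2"
    using assms by linarith
  then have "\<alpha> < \<beta>" by simp
  have "0 < U" using U \<alpha> \<open>\<alpha> < \<beta>\<close> by linarith
  have S: "S = {w. 0 < Re w} \<inter> {w. Re w < (N + 1) / sqrt 2}"
    by (auto simp: S_def)
  have "open S" "convex S"
    unfolding S by (intro open_Int open_halfspace_Re_gt open_halfspace_Re_lt
      convex_Int convex_halfspace_Re_gt convex_halfspace_Re_lt)+
  have hol: "?G holomorphic_on S - pts"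
  proof (rule holomorphic_on_subset[OF rotated_integrand_holomorphic])
    have "n \<le> N" if "Re (n * cis (pi / 4)) < (N + 1) / sqrt 2" for n :: nat
    proof -
      have "n / sqrt 2 < (N + 1) / sqrt 2"
        using that unfolding pole_coords .
      then have "real n < N + 1"
        by (simp only: divide_less_cancel) simp
      then show ?thesis by linarith
    qed
    then show "S - pts \<subseteq> {w. 0 < Re w} - (\<lambda>n::nat. n * cis (pi / 4)) ` {1..}"
      unfolding S_def pts_def by fastforce
  qed
  have pts_box: "p \<in> box a1 a3" if "p \<in> pts" for p
  proof -
    from that obtain n where n: "1 \<le> n" "n \<le> N" "p = of_nat n * cis (pi / 4)"
      by (auto simp: pts_def)
    have "\<alpha> * sqrt 2 < n" "n < \<beta> * sqrt 2"
      using n assms by (smt (verit) of_nat_1 of_nat_mono)+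
    then have "\<alpha> < n / sqrt 2" "n / sqrt 2 < \<beta>"
      by (simp_all add: field_simps)
    moreover have "n / sqrt 2 < U" "- U < n / sqrt 2"
      using calculation \<alpha> U by linarith+
    ultimately show ?thesis
      unfolding in_box_complex_iff n(3) pole_coords a1_def a3_def by simp
  qed
  have rect: "path_image (rectpath a1 a3) = cbox a1 a3 - box a1 a3"
    using \<open>\<alpha> < \<beta>\<close> \<open>0 < U\<close> by (intro path_image_rectpath_cbox_minus_box) (auto simp: a1_def a3_def)
  have "\<beta> < (N + 1) / sqrt 2"
    using \<beta> by (simp add: field_simps)
  then have cbox_S: "cbox a1 a3 \<subseteq> S"
    using \<alpha> by (auto simp: S_def in_cbox_complex_iff a1_def a3_def)
  have rect_S: "path_image (rectpath a1 a3) \<subseteq> S - pts"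
    using cbox_S pts_box unfolding rect by auto
  have "contour_integral (rectpath a1 a3) ?G
      = 2 * pi * \<i> * (\<Sum>p\<in>pts. winding_number (rectpath a1 a3) p * residue ?G p)"
  proof (rule Residue_theorem[OF \<open>open S\<close> _ _ hol])
    show "\<forall>z. z \<notin> S \<longrightarrow> winding_number (rectpath a1 a3) z = 0"
      using cbox_S \<open>\<alpha> < \<beta>\<close> \<open>0 < U\<close>
      by (intro allI impI winding_number_rectpath_outside) (auto simp: a1_def a3_def)
  qed (use rect_S \<open>convex S\<close> in \<open>auto simp: pts_def convex_connected\<close>)
  also have "\<dots> = (\<Sum>p\<in>pts. 2 * pi * \<i> * residue ?G p)"
    using pts_box by (simp add: sum_distrib_left winding_number_rectpath cong: sum.cong)
  also have "cmod \<dots> \<le> (\<Sum>p\<in>pts. 1)"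
  proof (rule sum_norm_le)
    fix p assume "p \<in> pts"
    then obtain n :: nat where n: "1 \<le> n" "p = of_nat n * cis (pi / 4)"
      by (auto simp: pts_def)
    then show "cmod (2 * pi * \<i> * residue ?G p) \<le> 1"
      using norm_residue_rotated_integrand[OF n(1) s] by (simp only: n(2))
  qed
  also have "\<dots> \<le> N"
    using card_image_le[of "{1..N}" "\<lambda>n::nat. n * cis (pi / 4)"] by (simp add: pts_def)
  finally have total: "cmod (contour_integral (rectpath a1 a3) ?G) \<le> N" .

  have path: "path_image (rectpath a1 a3)
      = closed_segment a1 a2 \<union> closed_segment a2 a3 \<union> closed_segment a3 a4 \<union> closed_segment a4 a1"
    by (simp add: rectpath_def Let_def path_image_join a1_def a2_def a3_def a4_def Un_assoc)
  have cont: "continuous_on (path_image (rectpath a1 a3)) ?G"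
    using hol rect_S by (intro holomorphic_on_imp_continuous_on holomorphic_on_subset[OF hol])
  have int: "?G contour_integrable_on linepath a1 a2" "?G contour_integrable_on linepath a2 a3"
    "?G contour_integrable_on linepath a3 a4" "?G contour_integrable_on linepath a4 a1"
    by (intro contour_integrable_continuous_linepath continuous_on_subset[OF cont]; simp add: path; blast)+
  have edge: "cmod (contour_integral (linepath p q) ?G) \<le> ?B"
    if int: "?G contour_integrable_on linepath p q" and "Im p = Im q" "\<bar>Im q\<bar> = U"
      and "Re p = \<alpha> \<and> Re q = \<beta> \<or> Re p = \<beta> \<and> Re q = \<alpha>" for p q
  proof -
    have "cmod (contour_integral (linepath p q) ?G)
        \<le> exp (pi * (\<bar>Im s\<bar> + \<beta>\<^sup>2) - pi * U\<^sup>2) * cmod (q - p)"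
    proof (rule contour_integral_bound_linepath[OF int])
      fix w assume "w \<in> closed_segment p q"
      then show "cmod (?G w) \<le> exp (pi * (\<bar>Im s\<bar> + \<beta>\<^sup>2) - pi * U\<^sup>2)"
        using \<alpha> \<open>\<alpha> < \<beta>\<close> U s that
        by (intro norm_rotated_integrand_edge_le)
          (auto simp: closed_segment_same_Im closed_segment_eq_real_ivl)
    qed simp
    moreover have "cmod (q - p) = \<beta> - \<alpha>"
      using that \<open>\<alpha> < \<beta>\<close> by (auto simp: cmod_def)
    ultimately show ?thesis by simp
  qed
  have "contour_integral (rectpath a1 a3) ?G
      = contour_integral (linepath a1 a2) ?G + (contour_integral (linepath a2 a3) ?G
        + (contour_integral (linepath a3 a4) ?G + contour_integral (linepath a4 a1) ?G))"
    using int by (simp add: rectpath_def Let_def contour_integrable_join a1_def a2_def a3_def a4_def)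
  moreover have "contour_integral (linepath a2 a3) ?G = \<i> * integral {-U..U} (\<lambda>y. ?G (Complex \<beta> y))"
    using \<open>0 < U\<close> by (intro contour_integral_linepath_same_Re) (auto simp: a2_def a3_def)
  moreover have "contour_integral (linepath a4 a1) ?G = - (\<i> * integral {-U..U} (\<lambda>y. ?G (Complex \<alpha> y)))"
  proof -
    have "contour_integral (linepath a4 a1) ?G = - contour_integral (linepath a1 a4) ?G"
      by (intro contour_integral_reverse_linepath continuous_on_subset[OF cont]) (auto simp: path)
    also have "contour_integral (linepath a1 a4) ?G = \<i> * integral {-U..U} (\<lambda>y. ?G (Complex \<alpha> y))"
      using \<open>0 < U\<close> by (intro contour_integral_linepath_same_Re) (auto simp: a1_def a4_def)
    finally show ?thesis .
  qed
  \<comment> \<open>The decomposition of the rectangle integral, solved for the left side, which is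
    traversed downwards.\<close>
  ultimately have eq: "\<i> * integral {-U..U} (\<lambda>y. ?G (Complex \<alpha> y))
      = contour_integral (linepath a1 a2) ?G + (\<i> * integral {-U..U} (\<lambda>y. ?G (Complex \<beta> y))
        + (contour_integral (linepath a3 a4) ?G - contour_integral (rectpath a1 a3) ?G))"
    by (simp add: algebra_simps)
  have edges: "cmod (contour_integral (linepath a1 a2) ?G) \<le> ?B"
    "cmod (contour_integral (linepath a3 a4) ?G) \<le> ?B"
    using int \<open>0 < U\<close> by (auto intro!: edge simp: a1_def a2_def a3_def a4_def)
  have "cmod (integral {-U..U} (\<lambda>y. ?G (Complex \<alpha> y))) = cmod (\<i> * integral {-U..U} (\<lambda>y. ?G (Complex \<alpha> y)))"
    by (simp add: norm_mult)
  also have "\<dots> \<le> ?B + (cmod (\<i> * integral {-U..U} (\<lambda>y. ?G (Complex \<beta> y))) + (?B + N))"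
    unfolding eq using edges total
    by (intro norm_triangle_le add_mono norm_triangle_le_diff order_refl)
  finally show ?thesis by (simp add: norm_mult algebra_simps)
qed

section \<open>Passage to the infinite line and conclusion\<close>

text \<open>After rotation and the translation \<open>y = c / sqrt 2 + u\<close> the two integrals
  differ by a sign, from the reversed orientation, and by the unimodular factor
  \<open>cis (pi / 4)\<close>.\<close>

lemma riemann_aux_rotated:
  "cmod (riemann_aux c s) = cmod (LINT y|lborel. rotated_integrand s (Complex (c / sqrt 2) y))"
proof -
  have "cis (- pi / 4) * Complex (c / sqrt 2) (c / sqrt 2 + u) = c + u * cis (pi / 4)" for u
    by (simp add: complex_eq_iff cos_45 sin_45 field_simps)
  then have eq: "rotated_integrand s (Complex (c / sqrt 2) (c / sqrt 2 + 1 * u))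
      = riemann_aux_integrand s (c + u * cis (pi / 4))" for u
    by (simp add: rotated_integrand_def)
  have "riemann_aux c s = - (LINT (u::real)|lborel. riemann_aux_integrand s (c + u * cis (pi / 4)) * cis (pi / 4))"
    by (simp add: riemann_aux_def interval_lebesgue_integral_def set_lebesgue_integral_def)
  also have "\<dots> = - ((LINT (u::real)|lborel. riemann_aux_integrand s (c + u * cis (pi / 4))) * cis (pi / 4))"
    by simp
  also have "(LINT (u::real)|lborel. riemann_aux_integrand s (c + u * cis (pi / 4)))
      = (LINT y|lborel. rotated_integrand s (Complex (c / sqrt 2) y))"
    unfolding eq[symmetric]
    using lborel_integral_real_affine[of 1 "\<lambda>y. rotated_integrand s (Complex (c / sqrt 2) y)" "c / sqrt 2"]
    by simp
  finally show ?thesis by (simp add: norm_mult)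
qed

text \<open>Links the Lebesgue integral defining the function with the gauge integrals over the
  sides of finite rectangles.\<close>

lemma truncated_integral_tendsto:
  fixes g :: "real \<Rightarrow> complex"
  assumes "integrable lborel g"
  shows "(\<lambda>n. integral {- real n..real n} g) \<longlonglongrightarrow> (LINT y|lborel. g y)"
proof -
  have si: "set_integrable lborel A g" if "A \<in> sets lborel" for A
    using assms that unfolding set_integrable_def by (intro integrable_mult_indicator)
  have "(\<Union>n. {- real n..real n}) = UNIV"
  proof -
    have "\<exists>n. - real n \<le> x \<and> x \<le> real n" for x
    proof -
      obtain n where "\<bar>x\<bar> \<le> real n"
        using real_arch_simple by blast
      then show ?thesis
        by (intro exI[of _ n]) linarith
    qed
    then show ?thesis by auto
  qed
  then have "(\<lambda>n. LINT y:{- real n..real n}|lborel. g y) \<longlonglongrightarrow> (LINT y:UNIV|lborel. g y)"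
    using set_integral_cont_up[of "\<lambda>n. {- real n..real n}" lborel g] si
    by (auto simp: incseq_def)
  then show ?thesis
    using set_borel_integral_eq_integral(2)[OF si] by (simp add: set_lebesgue_integral_def)
qed

theorem proposition12:
  fixes c \<sigma> t :: real
  assumes "0 < c" and "c < 1"
    and "\<sigma> > 0" and "t > 16 * pi"
  shows "cmod (riemann_aux c (Complex \<sigma> t)) \<le> 2 * sqrt (t / (2 * pi))"
proof (cases "integrable lborel (\<lambda>y. rotated_integrand (Complex \<sigma> t) (Complex (c / sqrt 2) y))")
  case False
  \<comment> \<open>The Bochner integral of a non-integrable function is \<open>0\<close>.\<close>
  have "0 \<le> t" using assms(4) pi_gt_zero by linarith
  then show ?thesis
    using False by (simp add: riemann_aux_rotated not_integrable_integral_eq)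
next
  case True
  define s where "s = Complex \<sigma> t"
  define \<eta> where "\<eta> = sqrt (t / (2 * pi))"
  define N where "N = nat \<lfloor>\<eta>\<rfloor>"
  define a where "a = N + (1/2 :: real)"
  \<comment> \<open>Rotation turns the line through \<open>a\<close> into the vertical line with
    real part \<open>a / sqrt 2\<close>.\<close>
  define \<beta> where "\<beta> = a / sqrt 2"
  define M where "M = (exp (pi * ((\<eta>\<^sup>2 - a\<^sup>2) / a)\<^sup>2 / 2) + sqrt 2 * exp (- pi)) / 2"
  have "0 < t" using assms(4) pi_gt_zero by (smt (verit))
  then have \<eta>2: "\<eta>\<^sup>2 = t / (2 * pi)" and "0 \<le> \<eta>"
    by (simp_all add: \<eta>_def)
  then have t: "t = 2 * pi * \<eta>\<^sup>2"
    by simp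
  have "8 < \<eta>\<^sup>2"
    using assms(4) unfolding \<eta>2 by (simp add: less_divide_eq)
  have N\<eta>: "real N \<le> \<eta>" "\<eta> < N + 1"
    using \<open>0 \<le> \<eta>\<close> unfolding N_def by (simp, linarith)
  note num = saddle_numerics[OF N\<eta> \<open>8 < \<eta>\<^sup>2\<close> a_def]
  \<comment> \<open>Contribution of the two horizontal edges, which vanishes as \<open>U\<close>
    grows.\<close>
  define e where "e = (\<lambda>U. 2 * (exp (pi * (\<bar>Im s\<bar> + \<beta>\<^sup>2) - pi * U\<^sup>2) * (\<beta> - c / sqrt 2)))"
  have bound: "cmod (integral {- U..U} (\<lambda>y. rotated_integrand s (Complex (c / sqrt 2) y))) \<le> M + N + e U"
    if U: "\<beta> + 2 \<le> U" for U
  proof -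
    have "continuous_on {- U..U} (\<lambda>y. rotated_integrand s (Complex \<beta> y))"
    proof (rule continuous_on_compose2[OF holomorphic_on_imp_continuous_on[OF rotated_integrand_holomorphic]])
      show "continuous_on {- U..U} (\<lambda>y. Complex \<beta> y)"
        by (simp add: Complex_eq continuous_intros)
      have "Complex \<beta> y \<noteq> of_nat n * cis (pi / 4)" for y and n :: nat
      proof
        assume "Complex \<beta> y = of_nat n * cis (pi / 4)"
        from arg_cong[OF this, of Re] have "\<beta> = n / sqrt 2"
          unfolding pole_coords by simp
        \<comment> \<open>The line through a half-integer meets no pole, by parity.\<close>
        then have "real (2 * N + 1) = real (2 * n)"
          by (simp add: \<beta>_def a_def)
        then show False unfolding of_nat_eq_iff by presburger
      qed
      moreover have "0 < \<beta>" by (simp add: \<beta>_def a_def)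
      ultimately show "(\<lambda>y. Complex \<beta> y) ` {- U..U} \<subseteq> {w. 0 < Re w} - (\<lambda>n::nat. n * cis (pi / 4)) ` {1..}"
        by auto
    qed
    then have "cmod (integral {- U..U} (\<lambda>y. rotated_integrand s (Complex \<beta> y))) \<le> M"
      unfolding s_def t \<beta>_def M_def rotated_integrand_def
      using num(1,2) assms(3) by (intro saddle_line_bound[OF _ a_def])
    moreover have "cmod (integral {- U..U} (\<lambda>y. rotated_integrand s (Complex (c / sqrt 2) y)))
      \<le> cmod (integral {- U..U} (\<lambda>y. rotated_integrand s (Complex \<beta> y))) + N + e U"
      unfolding e_def using assms num(1) U
      by (intro line_integral_shift) (auto simp: s_def \<beta>_def a_def)
    ultimately show ?thesis by linarith
  qed
  have "(\<lambda>n. M + N + e (real n)) \<longlonglongrightarrow> M + N + 0"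
    unfolding e_def by (intro tendsto_add tendsto_const) real_asymp
  moreover have "(\<lambda>n. cmod (integral {- real n..real n} (\<lambda>y. rotated_integrand s (Complex (c / sqrt 2) y))))
      \<longlonglongrightarrow> cmod (LINT y|lborel. rotated_integrand s (Complex (c / sqrt 2) y))"
    using True unfolding s_def by (intro tendsto_norm truncated_integral_tendsto)
  moreover have "\<forall>\<^sub>F n in sequentially.
      cmod (integral {- real n..real n} (\<lambda>y. rotated_integrand s (Complex (c / sqrt 2) y))) \<le> M + N + e (real n)"
    using eventually_ge_at_top[of "nat \<lceil>\<beta> + 2\<rceil>"]
    by eventually_elim (rule bound, linarith)
  ultimately have "cmod (LINT y|lborel. rotated_integrand s (Complex (c / sqrt 2) y)) \<le> M + N + 0"
    by (rule tendsto_le[OF sequentially_bot])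
  also have "\<dots> \<le> 2 * \<eta>"
    using num(3) by (simp add: M_def)
  finally show ?thesis
    unfolding riemann_aux_rotated s_def \<eta>_def .
qed

end
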